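(* Let $\gamma\in\mathbb R$, let $\hat J_\gamma$ be the Markovian part of the Feynman–Kac transform of a Markov additive kernel $J$ on $\mathbb Z\times\hat S$, with convergence parameter $R(\hat J_\gamma)$, and let $\Psi(\gamma,u)=\sum_n f^n_\gamma(\hat y,\hat y)u^n$ be the generating function of the first-return weights at a fixed state $\hat y\in\hat S$, as defined in the context. Then $$R(\hat J_\gamma)=\sup\{u:\Psi(\gamma,u)\le1\}.$$ Also, $\hat J_\gamma$ is $R(\hat J_\gamma)$-recurrent if and only if $\Psi(\gamma,R(\hat J_\gamma))=1$.
   Context: $\hat S$ is countable and $(V,Z)$ is a Markov chain on $\mathbb Z\times\hat S$ with kernel $J$ satisfying $J((z_1,\hat z),(x_1,\hat x))=J((0,\hat z),(x_1-z_1,\hat x))$; the marginal chain $Z$, with kernel $\hat J(\hat z,\hat x)=\sum_vJ((0,\hat z),(v,\hat x))$, is assumed irreducible. For real $\gamma$ the Feynman–Kac transform is $J_\gamma((x_1,\hat x),(y_1,\hat y))=e^{\gamma(y_1-x_1)}J((x_1,\hat x),(y_1,\hat y))$ and its Markovian part is $\hat J_\gamma(\hat x,\hat y)=\sum_vJ_\gamma((0,\hat x),(v,\hat y))$, assumed finite for all $\hat x,\hat y\in\hat S$. $\hat J_\gamma$ is an irreducible nonnegative matrix; $r(\hat J_\gamma)$ is its spectral radius (the limit of $(\hat J_\gamma^n(\hat y,\hat y))^{1/n}$, as a limsup in the periodic case) and $R(\hat J_\gamma)=1/r(\hat J_\gamma)$ its convergence parameter, i.e. the radius of convergence of $\sum_n\hat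 J_\gamma^n(\hat y,\hat y)u^n$. $\hat J_\gamma$ is $R$-recurrent (with $R=R(\hat J_\gamma)$) if $\sum_n\hat J_\gamma^n(\hat y,\hat y)R^n=\infty$, and $R$-transient otherwise. For a fixed $\hat y$, for $n\ge1$, $$f^n_\gamma(\hat y,\hat y)=\sum_{\hat y[1]\ne\hat y,\dots,\hat y[n-1]\ne\hat y,\ \hat y[n]=\hat y}\hat J_\gamma(\hat y,\hat y[1])\hat J_\gamma(\hat y[1],\hat y[2])\cdots\hat J_\gamma(\hat y[n-1],\hat y[n]).$$ In the supremum $u$ ranges over nonnegative reals. *)

theory Defs
  imports "HOL-Probability.Probability"
begin

text \<open>
  Nonnegative matrices over a countable index type are functions with values in \<^typ>\<open>ennreal\<close>:
  finite entries do not guarantee finite entries of the powers. As usual, \<open>0 * \<infinity> = 0\<close>.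
\<close>

type_synonym 's matrix = "'s \<Rightarrow> 's \<Rightarrow> ennreal"

primrec matrix_pow :: "'s matrix \<Rightarrow> nat \<Rightarrow> 's matrix" where
  "matrix_pow K 0 x y = (if x = y then 1 else 0)"
| "matrix_pow K (Suc n) x y = (\<integral>\<^sup>+ z. K x z * matrix_pow K n z y \<partial>count_space UNIV)"

definition irreducible_matrix :: "'s matrix \<Rightarrow> bool" where
  "irreducible_matrix K \<longleftrightarrow> (\<forall>x y. \<exists>n>0. matrix_pow K n x y > 0)"

definition ennroot :: "nat \<Rightarrow> ennreal \<Rightarrow> ennreal" where
  "ennroot n a = (if a = \<infinity> then \<infinity> else ennreal (root n (enn2real a)))"

text \<open>
  The spectral radius, the convergence parameter and recurrence are computed from the diagonal
  entries at a reference state \<open>x\<close>; for irreducible \<open>K\<close> its choice is immaterial.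
  The values \<open>r = \<infinity>\<close>, \<open>R = 0\<close> are possible.
\<close>

definition spectral_radius_at :: "'s matrix \<Rightarrow> 's \<Rightarrow> ennreal" where
  "spectral_radius_at K x = limsup (\<lambda>n. ennroot n (matrix_pow K n x x))"

definition conv_parameter_at :: "'s matrix \<Rightarrow> 's \<Rightarrow> ennreal" where
  "conv_parameter_at K x = 1 / spectral_radius_at K x"

definition R_recurrent_at :: "'s matrix \<Rightarrow> 's \<Rightarrow> bool" where
  "R_recurrent_at K x \<longleftrightarrow> (\<Sum>n. matrix_pow K n x x * conv_parameter_at K x ^ n) = \<infinity>"

fun path_weight :: "'s matrix \<Rightarrow> 's list \<Rightarrow> ennreal" where
  "path_weight K (x # y # ys) = K x y * path_weight K (y # ys)"
| "path_weight K _ = 1"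

text \<open>
  \<open>first_return K y n\<close> is meant for \<open>n \<ge> 1\<close>; the list \<open>p\<close> holds the intermediate states
  visited at times \<open>1, \<dots>, n - 1\<close>.
\<close>

definition first_return :: "'s matrix \<Rightarrow> 's \<Rightarrow> nat \<Rightarrow> ennreal" where
  "first_return K y n =
     (\<integral>\<^sup>+ p. path_weight K (y # p @ [y]) \<partial>count_space {p. length p = n - 1 \<and> y \<notin> set p})"

definition first_return_gf :: "'s matrix \<Rightarrow> 's \<Rightarrow> ennreal \<Rightarrow> ennreal" where
  "first_return_gf K y u = (\<Sum>n. first_return K y (Suc n) * u ^ Suc n)"

definition markov_additive :: "(int \<times> 's \<Rightarrow> (int \<times> 's) pmf) \<Rightarrow> bool" where
  "markov_additive J \<longleftrightarrow>
     (\<forall>z1 z x1 x. pmf (J (z1, z)) (x1, x) = pmf (J (0, z)) (x1 - z1, x))"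

definition marginal_kernel :: "(int \<times> 's \<Rightarrow> (int \<times> 's) pmf) \<Rightarrow> 's matrix" where
  "marginal_kernel J z x = (\<integral>\<^sup>+ v. ennreal (pmf (J (0, z)) (v, x)) \<partial>count_space UNIV)"

definition feynman_kac ::
  "(int \<times> 's \<Rightarrow> (int \<times> 's) pmf) \<Rightarrow> real \<Rightarrow> int \<times> 's \<Rightarrow> int \<times> 's \<Rightarrow> real" where
  "feynman_kac J \<gamma> a b = exp (\<gamma> * real_of_int (fst b - fst a)) * pmf (J a) b"

definition markovian_part :: "(int \<times> 's \<Rightarrow> (int \<times> 's) pmf) \<Rightarrow> real \<Rightarrow> 's matrix" where
  "markovian_part J \<gamma> x y =
     (\<integral>\<^sup>+ v. ennreal (feynman_kac J \<gamma> (0, x) (v, y)) \<partial>count_space UNIV)"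

definition Psi :: "(int \<times> 's \<Rightarrow> (int \<times> 's) pmf) \<Rightarrow> 's \<Rightarrow> real \<Rightarrow> ennreal \<Rightarrow> ennreal" where
  "Psi J y \<gamma> u = first_return_gf (markovian_part J \<gamma>) y u"

end

theory Submission
  imports Defs
begin

text \<open>
  Write \<open>G(u) = \<Sum>n. K\<^sup>n(y,y) u\<^sup>n\<close> for the Green function of a nonnegative matrix and \<open>F(u)\<close> for the
  generating function of the first-return weights. Splitting a closed path at its first return
  gives the renewal equation \<open>G(u) = 1 + F(u) G(u)\<close>, read in \<open>[0,\<infinity>]\<close>. If \<open>F(u) \<ge> 1\<close> it forces
  \<open>G(u) = \<infinity>\<close>. If \<open>F(u) < 1\<close>, the equation still has the solution \<open>G(u) = \<infinity>\<close>, so its truncated form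
  is used: by induction all partial sums of \<open>G(u)\<close> stay below \<open>1 / (1 - F(u))\<close>. Thus \<open>G(u) < \<infinity>\<close>
  exactly when \<open>F(u) < 1\<close> (\<open>green_finite_iff_first_return_gf\<close>).

  By the root test, the convergence parameter \<open>R\<close> separates the \<open>u\<close> with \<open>G(u) < \<infinity>\<close> from those with
  \<open>G(u) = \<infinity>\<close>, so \<open>F < 1\<close> below \<open>R\<close> and \<open>F \<ge> 1\<close> above \<open>R\<close>. As \<open>F\<close> is a power series without constant
  term, \<open>F(t u) \<ge> t F(u)\<close> for \<open>t \<ge> 1\<close>; this improves \<open>F \<ge> 1\<close> to \<open>F > 1\<close> above \<open>R\<close>, which identifies \<open>R\<close>
  as the supremum. Left continuity of \<open>F\<close> gives \<open>F(R) \<le> 1\<close>, so recurrence, which says that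
  \<open>G(R) = \<infinity>\<close>, that is \<open>F(R) \<ge> 1\<close>, amounts to \<open>F(R) = 1\<close>.

  The convergence parameter is computed at a state \<open>x\<close> and the returns are counted at a state \<open>y\<close>.
  Irreducibility bridges the two: paths from \<open>x\<close> to \<open>y\<close> and back turn divergence at \<open>y\<close> into
  divergence at \<open>x\<close>. The Feynman-Kac weight \<open>e\<^bsup>\<gamma>v\<^esup>\<close> is positive, so the Markovian part has
  the zero pattern of the marginal kernel and inherits its irreducibility.
\<close>

section \<open>Powers of a nonnegative matrix\<close>

text \<open>A path from \<open>x\<close> to \<open>z\<close> followed by one from \<open>z\<close> to \<open>y\<close> is one of the paths from \<open>x\<close> to \<open>y\<close>.\<close>

lemma matrix_pow_add_ge:
  "matrix_pow K m x z * matrix_pow K n z y \<le> matrix_pow K (m + n) x y"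
proof (induction m arbitrary: x)
  case 0
  then show ?case by simp
next
  case (Suc m)
  have "matrix_pow K (Suc m) x z * matrix_pow K n z y
      = (\<integral>\<^sup>+ w. K x w * (matrix_pow K m w z * matrix_pow K n z y) \<partial>count_space UNIV)"
    by (simp add: nn_integral_multc[symmetric] mult.assoc)
  also have "\<dots> \<le> (\<integral>\<^sup>+ w. K x w * matrix_pow K (m + n) w y \<partial>count_space UNIV)"
    by (intro nn_integral_mono mult_left_mono Suc.IH) simp
  finally show ?case by simp
qed

lemma matrix_pow_diag_power_le: "matrix_pow K n x x ^ k \<le> matrix_pow K (n * k) x x"
proof (induction k)
  case 0
  then show ?case by simp
next
  case (Suc k)
  have "matrix_pow K n x x ^ Suc k \<le> matrix_pow K n x x * matrix_pow K (n * k) x x"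
    using Suc by (simp add: mult_left_mono)
  also have "\<dots> \<le> matrix_pow K (n * Suc k) x x"
    using matrix_pow_add_ge[of K n x x "n * k" x] by simp
  finally show ?case .
qed

lemma nn_integral_count_space_pos_iff:
  "0 < (\<integral>\<^sup>+ z. f z \<partial>count_space UNIV) \<longleftrightarrow> (\<exists>z. 0 < f z)"
  using nn_integral_0_iff_AE[of f "count_space UNIV"]
  by (auto simp: AE_count_space zero_less_iff_neq_zero)

text \<open>An entry of \<open>K\<^sup>n\<close> is positive exactly when some path of length \<open>n\<close> uses only positive entries,
  so irreducibility can be read off from the zero pattern of \<open>K\<close>.\<close>

lemma matrix_pow_pos_cong:
  assumes "\<And>x y. 0 < K x y \<longleftrightarrow> 0 < L x y"
  shows "0 < matrix_pow K n x y \<longleftrightarrow> 0 < matrix_pow L n x y"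
proof (induction n arbitrary: x)
  case 0
  then show ?case by simp
next
  case (Suc n)
  show ?case
    unfolding matrix_pow.simps nn_integral_count_space_pos_iff ennreal_zero_less_mult_iff using assms Suc by simp
qed

section \<open>The Green function and the root test\<close>

definition green :: "'s matrix \<Rightarrow> 's \<Rightarrow> ennreal \<Rightarrow> ennreal" where
  "green K x u = (\<Sum>n. matrix_pow K n x x * u ^ n)"

text \<open>This holds also at \<open>\<infinity>\<close>, so that estimates for the roots can be raised to the \<open>n\<close>-th power
  without a case distinction.\<close>

lemma ennroot_power: "0 < n \<Longrightarrow> ennroot n a ^ n = a"
  by (auto simp: ennroot_def ennreal_power top_power_ennreal real_root_pow_pos2 less_top)

text \<open>Prefixing a path from \<open>x\<close> to \<open>y\<close> and appending one from \<open>y\<close> to \<open>x\<close> turns each loop at \<open>y\<close>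
  into a loop at \<open>x\<close>; so up to a shift of the index, the series at \<open>x\<close> dominates a positive
  multiple of the series at \<open>y\<close>.\<close>

lemma green_infinite_transfer:
  assumes "irreducible_matrix K" "u \<noteq> 0" "green K y u = \<infinity>"
  shows "green K x u = \<infinity>"
proof -
  obtain a where a: "matrix_pow K a x y > 0"
    using assms(1) unfolding irreducible_matrix_def by blast
  obtain b where b: "matrix_pow K b y x > 0"
    using assms(1) unfolding irreducible_matrix_def by blast
  define c where "c = matrix_pow K a x y * matrix_pow K b y x * u ^ (a + b)"
  have c: "c \<noteq> 0"
    using a b assms(2) by (auto simp: c_def)
  have step: "c * (matrix_pow K n y y * u ^ n) \<le> matrix_pow K (n + (a + b)) x x * u ^ (n + (a + b))" for n
  proof -
    have "matrix_pow K a x y * matrix_pow K n y y * matrix_pow K b y x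
        \<le> matrix_pow K (a + n) x y * matrix_pow K b y x"
      by (intro mult_right_mono matrix_pow_add_ge) simp
    also have "\<dots> \<le> matrix_pow K (a + n + b) x x"
      by (rule matrix_pow_add_ge)
    finally have "matrix_pow K a x y * matrix_pow K n y y * matrix_pow K b y x * u ^ (n + (a + b))
       \<le> matrix_pow K (a + n + b) x x * u ^ (n + (a + b))"
      by (rule mult_right_mono) simp
    then show ?thesis
      by (simp add: c_def power_add ac_simps)
  qed
  have "\<infinity> = c * green K y u"
    using c assms(3) by (simp add: ennreal_mult_top)
  also have "\<dots> = (\<Sum>n. c * (matrix_pow K n y y * u ^ n))"
    by (simp add: green_def ennreal_suminf_cmult)
  also have "\<dots> \<le> (\<Sum>n. matrix_pow K (n + (a + b)) x x * u ^ (n + (a + b)))"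
    by (intro suminf_le step) simp_all
  also have "\<dots> \<le> green K x u"
    unfolding green_def
    by (subst suminf_offset[of "\<lambda>n. matrix_pow K n x x * u ^ n" "a + b"]) simp_all
  finally show ?thesis by (simp add: top_unique)
qed

lemma green_zero: "green K x 0 = 1"
proof -
  have "green K x 0 = (\<Sum>n\<in>{0}. matrix_pow K n x x * 0 ^ n)"
    unfolding green_def by (rule suminf_finite) (auto simp: power_0_left)
  then show ?thesis by simp
qed

lemma green_finite_iff:
  assumes "irreducible_matrix K"
  shows "green K x u < \<infinity> \<longleftrightarrow> green K y u < \<infinity>"
  using green_infinite_transfer[OF assms, of u x y] green_infinite_transfer[OF assms, of u y x]
  by (cases "u = 0") (auto simp: green_zero less_top[symmetric])

text \<open>The root test controls only the late terms of a series, whereas a single infinite term makes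
  the Green function infinite. Early infinite terms are excluded here: by supermultiplicativity
  an infinite diagonal entry of \<open>K\<^sup>n\<close> recurs at all positive multiples of \<open>n\<close>.\<close>

lemma matrix_pow_diag_finite:
  assumes "spectral_radius_at K x < \<infinity>"
  shows "matrix_pow K n x x < \<infinity>"
proof (rule ccontr)
  assume "\<not> matrix_pow K n x x < \<infinity>"
  then have inf: "matrix_pow K n x x = \<infinity>" by (simp add: less_top[symmetric])
  then have n: "n \<noteq> 0" by (cases n) auto
  have "eventually (\<lambda>k. ennroot k (matrix_pow K k x x) < \<infinity>) sequentially"
    using assms unfolding spectral_radius_at_def by (rule Limsup_lessD)
  then obtain N where N: "\<And>k. k \<ge> N \<Longrightarrow> ennroot k (matrix_pow K k x x) < \<infinity>"
    by (auto simp: eventually_sequentially)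
  have "matrix_pow K (n * Suc N) x x = \<infinity>"
    using matrix_pow_diag_power_le[of K n x "Suc N"] inf by (simp add: top_unique top_power_ennreal del: power_Suc mult_Suc_right)
  moreover have "n * Suc N \<ge> N" using n by (cases n) auto
  ultimately show False
    using N[of "n * Suc N"] by (simp add: ennroot_def)
qed

lemma ennreal_less_one_divide_iff: "u < 1 / r \<longleftrightarrow> r < 1 / (u :: ennreal)"
proof (cases "r = 0 \<or> u = 0 \<or> r = \<infinity> \<or> u = \<infinity>")
  case True
  then show ?thesis
    by (auto simp: ennreal_zero_less_divide less_top[symmetric] ennreal_divide_eq_top_iff)
next
  case False
  then obtain a b where "r = ennreal a" "u = ennreal b" "0 < a" "0 < b"
    by (cases r; cases u) auto
  then show ?thesis
    by (simp add: ennreal_1[symmetric] divide_ennreal ennreal_less_iff field_simps del: ennreal_1)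
qed

lemma ennreal_one_divide_less_iff: "1 / r < u \<longleftrightarrow> 1 / u < (r :: ennreal)"
proof (cases "r = 0 \<or> u = 0 \<or> r = \<infinity> \<or> u = \<infinity>")
  case True
  then show ?thesis
    by (auto simp: ennreal_zero_less_divide less_top[symmetric] ennreal_divide_eq_top_iff zero_less_iff_neq_zero)
next
  case False
  then obtain a b where "r = ennreal a" "u = ennreal b" "0 < a" "0 < b"
    by (cases r; cases u) auto
  then show ?thesis
    by (simp add: ennreal_1[symmetric] divide_ennreal ennreal_less_iff field_simps del: ennreal_1)
qed

lemma green_finite_below:
  assumes "u < conv_parameter_at K x"
  shows "green K x u < \<infinity>"
proof (cases "u = 0")
  case True
  then show ?thesis by (simp add: green_zero)
next
  case False
  let ?r = "spectral_radius_at K x" and ?a = "\<lambda>n. matrix_pow K n x x * u ^ n"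
  have u: "u < \<infinity>" using assms by (auto intro: order.strict_trans2)
  have r: "?r < 1 / u"
    using assms unfolding conv_parameter_at_def ennreal_less_one_divide_iff[of u] .
  obtain w where w: "?r < w" "w < 1 / u" using dense[OF r] by blast
  have wu: "w * u < 1"
    using w(2) u False
    by (cases w; cases u) (auto simp: divide_ennreal ennreal_less_iff field_simps ennreal_mult[symmetric] ennreal_1[symmetric] simp del: ennreal_1)
  have "?r < \<infinity>" using w(1) by (auto intro: order.strict_trans2)
  then have fin: "?a n < \<infinity>" for n
    using matrix_pow_diag_finite[of K x n] u
    by (simp add: ennreal_mult_less_top power_less_top_ennreal)
  have "eventually (\<lambda>k. ennroot k (matrix_pow K k x x) < w) sequentially"
    using w(1) unfolding spectral_radius_at_def by (rule Limsup_lessD)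
  then obtain N where N: "\<And>k. k \<ge> N \<Longrightarrow> ennroot k (matrix_pow K k x x) < w"
    by (auto simp: eventually_sequentially)
  \<comment> \<open>The shift is by \<open>Suc N\<close>: the root of order \<open>0\<close> carries no information.\<close>
  have le: "?a (k + Suc N) \<le> (w * u) ^ k" for k
  proof -
    have "matrix_pow K (k + Suc N) x x = ennroot (k + Suc N) (matrix_pow K (k + Suc N) x x) ^ (k + Suc N)"
      by (rule ennroot_power[symmetric]) simp
    also have "\<dots> \<le> w ^ (k + Suc N)"
      by (rule power_mono[OF less_imp_le[OF N]]) simp_all
    finally have "?a (k + Suc N) \<le> (w * u) ^ (k + Suc N)"
      unfolding power_mult_distrib by (rule mult_right_mono) simp
    also have "\<dots> \<le> (w * u) ^ k"
      using wu by (intro power_decreasing) auto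
    finally show ?thesis .
  qed
  obtain q where q: "w * u = ennreal q" "0 \<le> q" "q < 1"
    using wu by (cases "w * u") (auto simp: ennreal_less_iff ennreal_1[symmetric] simp del: ennreal_1)
  have "(\<Sum>k. ?a (k + Suc N)) \<le> (\<Sum>k. (w * u) ^ k)"
    by (intro suminf_le le) simp_all
  also have "\<dots> = ennreal (\<Sum>k. q ^ k)"
    using q by (simp add: ennreal_power suminf_ennreal2)
  finally have "(\<Sum>k. ?a (k + Suc N)) < \<infinity>"
    by (auto intro: order.strict_trans1)
  moreover have "(\<Sum>k<Suc N. ?a k) < \<infinity>"
    using fin by (simp del: sum.lessThan_Suc)
  moreover have "green K x u = (\<Sum>k. ?a (k + Suc N)) + (\<Sum>k<Suc N. ?a k)"
    unfolding green_def by (rule suminf_offset) simp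
  ultimately show ?thesis by simp
qed

lemma green_infinite_above:
  assumes "conv_parameter_at K x < u"
  shows "green K x u = \<infinity>"
proof -
  let ?r = "spectral_radius_at K x" and ?a = "\<lambda>n. matrix_pow K n x x * u ^ n"
  have "1 / u < ?r"
    using assms unfolding conv_parameter_at_def ennreal_one_divide_less_iff[of _ u] .
  then have freq: "frequently (\<lambda>n. 1 / u < ennroot n (matrix_pow K n x x)) sequentially"
    unfolding spectral_radius_at_def frequently_def
    using Limsup_bounded[of "\<lambda>n. ennroot n (matrix_pow K n x x)" "1 / u" sequentially]
    by (auto simp: not_less)
  have u1: "1 / u * u = 1" if "u < \<infinity>"
  proof -
    have "0 < u" using assms by (rule le_less_trans[OF zero_le])
    with that obtain a where "u = ennreal a" "0 < a" by (cases u) auto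
    then show ?thesis
      by (simp add: divide_ennreal ennreal_mult[symmetric] ennreal_1[symmetric] del: ennreal_1)
  qed
  have big: "1 \<le> ?a n" if n: "0 < n" "1 / u < ennroot n (matrix_pow K n x x)" for n
  proof (cases "u < \<infinity>")
    case True
    have "(1 / u) ^ n \<le> ennroot n (matrix_pow K n x x) ^ n"
      using n by (intro power_mono) auto
    also have "\<dots> = matrix_pow K n x x" using n by (simp add: ennroot_power)
    finally have "(1 / u) ^ n * u ^ n \<le> ?a n" by (rule mult_right_mono) simp
    then show ?thesis
      unfolding power_mult_distrib[symmetric] u1[OF True] by simp
  next
    case False
    then have "u = \<infinity>" by (simp add: less_top[symmetric])
    moreover have "matrix_pow K n x x \<noteq> 0"
    proof
      assume "matrix_pow K n x x = 0"
      then show False using n by (simp add: ennroot_def)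
    qed
    ultimately show ?thesis using n by (simp add: top_power_ennreal ennreal_mult_top)
  qed
  show ?thesis
  proof (rule ccontr)
    assume "green K x u \<noteq> \<infinity>"
    then have sum: "(\<Sum>n. ?a n) \<noteq> top" by (simp add: green_def)
    then have fin: "?a n \<noteq> top" for n
      using ennreal_suminf_lessD[of ?a top n] by (auto simp: less_top)
    define f where "f n = enn2real (?a n)" for n
    have f: "?a n = ennreal (f n)" "0 \<le> f n" for n
      using fin[of n] by (simp_all add: f_def less_top)
    have "summable f"
      using sum f by (intro summable_suminf_not_top) simp_all
    then have "(\<lambda>n. ennreal (f n)) \<longlonglongrightarrow> ennreal 0"
      by (intro tendsto_ennrealI summable_LIMSEQ_zero)
    then have "?a \<longlonglongrightarrow> 0"
      by (simp add: f(1))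
    then have "eventually (\<lambda>n. ?a n < 1 \<and> 0 < n) sequentially"
      by (intro eventually_conj order_tendstoD eventually_gt_at_top) auto
    then have "eventually (\<lambda>n. \<not> 1 / u < ennroot n (matrix_pow K n x x)) sequentially"
      by (rule eventually_mono) (blast dest: leD big)
    with freq show False by (simp add: frequently_def)
  qed
qed

section \<open>The renewal equation\<close>

text \<open>Indexed by the number \<open>k\<close> of intermediate states, so that the passage takes \<open>k + 1\<close> steps. For
  \<open>z = y\<close> it is a first return rather than the trivial passage of length \<open>0\<close>.\<close>

definition first_passage :: "'s matrix \<Rightarrow> 's \<Rightarrow> nat \<Rightarrow> 's \<Rightarrow> ennreal" where
  "first_passage K y k z =
     (\<integral>\<^sup>+ p. path_weight K (z # p @ [y]) \<partial>count_space {p. length p = k \<and> y \<notin> set p})"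

lemma first_return_eq_first_passage: "first_return K y (Suc k) = first_passage K y k y"
  by (simp add: first_return_def first_passage_def)

lemma first_passage_0: "first_passage K y 0 z = K z y"
proof -
  have "{p. length p = 0 \<and> y \<notin> set p} = {[]}" by auto
  then show ?thesis by (simp add: first_passage_def nn_integral_count_space_finite)
qed

text \<open>Condition on the first step: it must avoid \<open>y\<close>, since the passage takes more than one step.\<close>

lemma first_passage_Suc:
  "first_passage K y (Suc k) z
     = (\<integral>\<^sup>+ w. K z w * first_passage K y k w * indicator (- {y}) w \<partial>count_space UNIV)"
proof -
  let ?A = "{p. length p = k \<and> y \<notin> set p}"
  let ?B = "{p. length p = Suc k \<and> y \<notin> set p}"
  let ?g = "\<lambda>(w, p). K z w * path_weight K (w # p @ [y])"
  have bij: "bij_betw (\<lambda>(w, p). w # p) ((- {y}) \<times> ?A) ?B"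
    by (rule bij_betwI[where g = "\<lambda>l. (hd l, tl l)"])
       (auto simp: length_Suc_conv)
  have "first_passage K y (Suc k) z
      = (\<integral>\<^sup>+ a. path_weight K (z # (\<lambda>(w, p). w # p) a @ [y]) \<partial>count_space ((- {y}) \<times> ?A))"
    unfolding first_passage_def by (rule nn_integral_bij_count_space[OF bij, symmetric])
  also have "\<dots> = (\<integral>\<^sup>+ a. ?g a * indicator ((- {y}) \<times> ?A) a \<partial>count_space UNIV)"
    by (subst nn_integral_count_space_indicator) (auto intro!: nn_integral_cong)
  also have "\<dots> = (\<integral>\<^sup>+ w. \<integral>\<^sup>+ p. ?g (w, p) * indicator ((- {y}) \<times> ?A) (w, p)
                     \<partial>count_space UNIV \<partial>count_space UNIV)"
    by (rule nn_integral_fst_count_space[symmetric])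
  also have "\<dots> = (\<integral>\<^sup>+ w. K z w * first_passage K y k w * indicator (- {y}) w \<partial>count_space UNIV)"
    unfolding first_passage_def
    by (subst nn_integral_count_space_indicator[of ?A])
       (auto intro!: nn_integral_cong simp: nn_integral_cmult[symmetric] nn_integral_multc[symmetric]
          split: split_indicator)
  finally show ?thesis .
qed

text \<open>Decomposition at the first visit to \<open>y\<close>. A general starting state \<open>z\<close> is needed because the
  induction on the number of steps moves the start.\<close>

lemma matrix_pow_first_passage:
  "matrix_pow K (Suc n) z y = (\<Sum>k\<le>n. first_passage K y k z * matrix_pow K (n - k) y y)"
proof (induction n arbitrary: z)
  case 0
  have "matrix_pow K (Suc 0) z y = (\<integral>\<^sup>+ w. K z y * indicator {y} w \<partial>count_space UNIV)"
    unfolding matrix_pow.simps by (intro nn_integral_cong) (auto split: split_indicator)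
  then show ?case by (simp add: nn_integral_cmult_indicator first_passage_0)
next
  case (Suc n)
  let ?P = "\<lambda>m. matrix_pow K m y y"
  have "matrix_pow K (Suc (Suc n)) z y
      = (\<integral>\<^sup>+ w. K z y * ?P (Suc n) * indicator {y} w
            + K z w * matrix_pow K (Suc n) w y * indicator (- {y}) w \<partial>count_space UNIV)"
    unfolding matrix_pow.simps(2)[of K "Suc n"]
    by (intro nn_integral_cong) (auto split: split_indicator)
  also have "\<dots> = K z y * ?P (Suc n)
      + (\<integral>\<^sup>+ w. K z w * matrix_pow K (Suc n) w y * indicator (- {y}) w \<partial>count_space UNIV)"
    by (subst nn_integral_add) (simp_all add: nn_integral_cmult_indicator)
  also have "(\<integral>\<^sup>+ w. K z w * matrix_pow K (Suc n) w y * indicator (- {y}) w \<partial>count_space UNIV)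
      = (\<integral>\<^sup>+ w. (\<Sum>k\<le>n. K z w * first_passage K y k w * indicator (- {y}) w * ?P (n - k))
           \<partial>count_space UNIV)"
    unfolding Suc.IH by (simp add: sum_distrib_left sum_distrib_right ac_simps)
  also have "\<dots> = (\<Sum>k\<le>n. first_passage K y (Suc k) z * ?P (n - k))"
    by (subst nn_integral_sum) (simp_all add: nn_integral_multc first_passage_Suc)
  finally show ?case
    unfolding sum.atMost_Suc_shift by (simp add: first_passage_0)
qed

lemma suminf_Cauchy_product_ennreal:
  fixes a b :: "nat \<Rightarrow> ennreal"
  shows "(\<Sum>n. \<Sum>k\<le>n. a k * b (n - k)) = (\<Sum>k. a k) * (\<Sum>m. b m)"
proof -
  let ?f = "\<lambda>k n. if k \<le> n then a k * b (n - k) else 0"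
  have row: "(\<Sum>n. ?f k n) = a k * (\<Sum>m. b m)" for k
  proof -
    have "(\<Sum>n. ?f k n) = (\<Sum>m. ?f k (m + k)) + (\<Sum>n<k. ?f k n)"
      by (rule suminf_offset) simp
    then show ?thesis by (simp add: ennreal_suminf_cmult)
  qed
  have "(\<Sum>n. \<Sum>k\<le>n. a k * b (n - k)) = (\<Sum>n. \<Sum>k. ?f k n)"
  proof (rule suminf_cong)
    fix n
    have "(\<Sum>k. ?f k n) = (\<Sum>k\<le>n. ?f k n)" by (rule suminf_finite) auto
    then show "(\<Sum>k\<le>n. a k * b (n - k)) = (\<Sum>k. ?f k n)" by simp
  qed
  also have "\<dots> = (\<Sum>k. \<Sum>n. ?f k n)"
    using nn_integral_suminf[of "\<lambda>k n. ?f k n" "count_space UNIV"]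
    by (simp add: nn_integral_count_space_nat)
  finally show ?thesis by (simp add: row ennreal_suminf_multc)
qed

lemma matrix_pow_renewal:
  "matrix_pow K (Suc n) y y * u ^ Suc n
     = (\<Sum>k\<le>n. (first_return K y (Suc k) * u ^ Suc k) * (matrix_pow K (n - k) y y * u ^ (n - k)))"
proof -
  have "u ^ Suc n = u ^ Suc k * u ^ (n - k)" if "k \<le> n" for k
    using that by (simp add: power_add[symmetric] mult.assoc)
  then show ?thesis
    unfolding matrix_pow_first_passage sum_distrib_right first_return_eq_first_passage
    by (intro sum.cong refl) (simp add: ac_simps)
qed

lemma green_renewal: "green K y u = 1 + first_return_gf K y u * green K y u"
proof -
  let ?a = "\<lambda>n. matrix_pow K n y y * u ^ n"
  have "green K y u = (\<Sum>n. ?a (n + 1)) + (\<Sum>n<1. ?a n)"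
    unfolding green_def by (rule suminf_offset) simp
  also have "\<dots> = 1 + (\<Sum>n. ?a (Suc n))" by (simp add: add.commute)
  also have "(\<Sum>n. ?a (Suc n)) = first_return_gf K y u * green K y u"
    unfolding matrix_pow_renewal first_return_gf_def green_def
    by (rule suminf_Cauchy_product_ennreal)
  finally show ?thesis .
qed

text \<open>The renewal equation alone does not exclude an infinite Green function; this recursive bound on
  partial sums will, since iterating it from \<open>0\<close> stays below every fixed point of
  \<open>g \<mapsto> 1 + F g\<close>.\<close>

lemma green_partial_renewal:
  "(\<Sum>n<Suc N. matrix_pow K n y y * u ^ n)
     \<le> 1 + first_return_gf K y u * (\<Sum>n<N. matrix_pow K n y y * u ^ n)"
proof -
  let ?a = "\<lambda>n. matrix_pow K n y y * u ^ n"
  let ?f = "\<lambda>k. first_return K y (Suc k) * u ^ Suc k"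
  \<comment> \<open>Truncating only this factor leaves the convolution unchanged up to index \<open>N - 1\<close>.\<close>
  let ?b = "\<lambda>n. if n < N then ?a n else 0"
  have "(\<Sum>n<N. ?a (Suc n)) = (\<Sum>n<N. \<Sum>k\<le>n. ?f k * ?b (n - k))"
    unfolding matrix_pow_renewal by (intro sum.cong refl) auto
  also have "\<dots> \<le> (\<Sum>n. \<Sum>k\<le>n. ?f k * ?b (n - k))"
    by (rule sum_le_suminf) auto
  also have "\<dots> = first_return_gf K y u * (\<Sum>m. ?b m)"
    unfolding suminf_Cauchy_product_ennreal[of ?f ?b] first_return_gf_def ..
  also have "(\<Sum>m. ?b m) = (\<Sum>m<N. ?b m)"
    by (rule suminf_finite) auto
  finally show ?thesis
    unfolding sum.lessThan_Suc_shift by (simp add: add_left_mono)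
qed

lemma green_finite_iff_first_return_gf: "green K y u < \<infinity> \<longleftrightarrow> first_return_gf K y u < 1"
proof
  assume fin: "green K y u < \<infinity>"
  show "first_return_gf K y u < 1"
  proof (rule ccontr)
    assume "\<not> first_return_gf K y u < 1"
    then have "1 * green K y u \<le> first_return_gf K y u * green K y u"
      by (intro mult_right_mono) (auto simp: not_less)
    then have "1 + green K y u \<le> green K y u"
      by (subst (2) green_renewal) (simp add: add_left_mono)
    with fin show False
      by (cases "green K y u") (auto simp: ennreal_1[symmetric] ennreal_plus[symmetric] simp del: ennreal_1 ennreal_plus)
  qed
next
  assume "first_return_gf K y u < 1"
  then obtain f where f: "first_return_gf K y u = ennreal f" "0 \<le> f" "f < 1"
    by (cases "first_return_gf K y u") (auto simp: ennreal_less_iff ennreal_1[symmetric] simp del: ennreal_1)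
  \<comment> \<open>the finite fixed point of \<open>g \<mapsto> 1 + F g\<close>\<close>
  define c where "c = ennreal (1 / (1 - f))"
  have c: "1 + first_return_gf K y u * c = c"
    using f by (simp add: c_def ennreal_mult[symmetric] ennreal_1[symmetric] ennreal_plus[symmetric] field_simps del: ennreal_1 ennreal_plus)
  have "(\<Sum>n<N. matrix_pow K n y y * u ^ n) \<le> c" for N
  proof (induction N)
    case 0
    then show ?case by simp
  next
    case (Suc N)
    have "1 + first_return_gf K y u * (\<Sum>n<N. matrix_pow K n y y * u ^ n)
        \<le> 1 + first_return_gf K y u * c"
      using Suc by (intro add_left_mono mult_left_mono) auto
    then show ?case
      using green_partial_renewal[of K y u N] unfolding c by (rule order_trans[rotated])
  qed
  then have "green K y u \<le> c"
    unfolding green_def by (intro suminf_le_const) simp_all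
  also have "c < \<infinity>" by (simp add: c_def)
  finally show "green K y u < \<infinity>" .
qed

section \<open>The first-return generating function at the convergence parameter\<close>

text \<open>All exponents in the series are at least \<open>1\<close>.\<close>

lemma first_return_gf_scale:
  assumes "1 \<le> t"
  shows "t * first_return_gf K y u \<le> first_return_gf K y (t * u)"
proof -
  have "t * (first_return K y (Suc n) * u ^ Suc n) \<le> first_return K y (Suc n) * (t * u) ^ Suc n" for n
  proof -
    have "t ^ 1 \<le> t ^ Suc n" using assms by (intro power_increasing) auto
    then have "t * (first_return K y (Suc n) * u ^ Suc n)
        \<le> t ^ Suc n * (first_return K y (Suc n) * u ^ Suc n)"
      by (intro mult_right_mono) auto
    then show ?thesis by (simp add: power_mult_distrib ac_simps)
  qed
  then show ?thesis
    unfolding first_return_gf_def ennreal_suminf_cmult[symmetric]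
    by (intro suminf_le) auto
qed

text \<open>For \<open>t < 1\<close>, the \<open>N\<close>-th partial sum at \<open>R\<close> times \<open>t\<^sup>N\<close> is at most the partial sum at \<open>t R\<close>, hence
  at most \<open>1\<close>; let \<open>t\<close> tend to \<open>1\<close>.\<close>

lemma first_return_gf_left_limit_le:
  assumes "R < \<infinity>" and less: "\<And>u. u < R \<Longrightarrow> first_return_gf K y u \<le> 1"
  shows "first_return_gf K y R \<le> 1"
proof (cases "R = 0")
  case True
  then show ?thesis by (simp add: first_return_gf_def)
next
  case False
  let ?t = "\<lambda>n. ennreal (1 - 1 / Suc n)"
  have t: "(\<lambda>n. ?t n ^ N) \<longlonglongrightarrow> 1" for N
  proof -
    have "(\<lambda>n. (1 - 1 / real (Suc n)) ^ N) \<longlonglongrightarrow> (1 - 0) ^ N"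
      by (intro tendsto_intros LIMSEQ_Suc[OF lim_1_over_n])
    then have "(\<lambda>n. ennreal ((1 - 1 / real (Suc n)) ^ N)) \<longlonglongrightarrow> ennreal 1"
      by (intro tendsto_ennrealI) simp
    moreover have "?t n ^ N = ennreal ((1 - 1 / real (Suc n)) ^ N)" for n
      by (rule ennreal_power) simp
    ultimately show ?thesis by (simp only: ennreal_1)
  qed
  have "(\<Sum>k<N. first_return K y (Suc k) * R ^ Suc k) \<le> 1" for N
  proof -
    let ?S = "\<Sum>k<N. first_return K y (Suc k) * R ^ Suc k"
    have "?t n ^ N * ?S \<le> 1" for n
    proof -
      have t1: "?t n < 1" by (simp add: ennreal_less_iff ennreal_1[symmetric] del: ennreal_1)
      have "?t n ^ N * ?S \<le> (\<Sum>k<N. first_return K y (Suc k) * (?t n * R) ^ Suc k)"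
        unfolding sum_distrib_left
      proof (rule sum_mono)
        fix k assume "k \<in> {..<N}"
        then have "?t n ^ N \<le> ?t n ^ Suc k"
          using t1 by (intro power_decreasing) auto
        then have "?t n ^ N * (first_return K y (Suc k) * R ^ Suc k)
            \<le> ?t n ^ Suc k * (first_return K y (Suc k) * R ^ Suc k)"
          by (rule mult_right_mono) simp
        then show "?t n ^ N * (first_return K y (Suc k) * R ^ Suc k)
            \<le> first_return K y (Suc k) * (?t n * R) ^ Suc k"
          by (simp add: power_mult_distrib ac_simps)
      qed
      also have "\<dots> \<le> first_return_gf K y (?t n * R)"
        unfolding first_return_gf_def by (rule sum_le_suminf) auto
      also have "\<dots> \<le> 1"
      proof (rule less)
        show "?t n * R < R"
          using t1 assms(1) False
          by (cases R) (auto simp: ennreal_mult[symmetric] ennreal_less_iff)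
      qed
      finally show ?thesis .
    qed
    moreover have "(\<lambda>n. ?t n ^ N * ?S) \<longlonglongrightarrow> 1 * ?S"
      by (intro tendsto_mult_ennreal t tendsto_const) auto
    ultimately show "?S \<le> 1"
      by (intro LIMSEQ_le_const2) auto
  qed
  then show ?thesis
    unfolding first_return_gf_def by (intro suminf_le_const) simp_all
qed

text \<open>If \<open>R = \<infinity>\<close>, then \<open>F < 1\<close> at all finite arguments. Since \<open>F\<close> grows at least linearly, \<open>F(1) = 0\<close>,
  so \<open>G(1) = 1\<close>: there is no loop at \<open>y\<close>, contrary to irreducibility.\<close>

lemma conv_parameter_finite:
  assumes "irreducible_matrix K"
  shows "conv_parameter_at K y < \<infinity>"
proof (rule ccontr)
  assume "\<not> conv_parameter_at K y < \<infinity>"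
  then have R: "conv_parameter_at K y = \<infinity>" by (simp add: less_top[symmetric])
  have F: "first_return_gf K y u < 1" if "u < \<infinity>" for u
    using that green_finite_below[of u K y] R green_finite_iff_first_return_gf by metis
  have "first_return_gf K y 1 = 0"
  proof (rule ccontr)
    assume nz: "first_return_gf K y 1 \<noteq> 0"
    obtain f where f: "first_return_gf K y 1 = ennreal f" "0 < f"  "f < 1"
      using F[of 1] nz by (cases "first_return_gf K y 1") (auto simp: ennreal_less_iff ennreal_1[symmetric] simp del: ennreal_1)
    have "ennreal (1 / f) * first_return_gf K y 1 \<le> first_return_gf K y (ennreal (1 / f) * 1)"
      using f by (intro first_return_gf_scale) (simp add: ennreal_1[symmetric] del: ennreal_1)
    moreover have "ennreal (1 / f) * first_return_gf K y 1 = 1"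
      using f by (simp add: ennreal_mult[symmetric])
    ultimately show False using F[of "ennreal (1 / f)"] by simp
  qed
  then have G: "green K y 1 = 1" using green_renewal[of K y 1] by simp
  obtain n where n: "0 < n" "0 < matrix_pow K n y y"
    using assms unfolding irreducible_matrix_def by blast
  have "(\<Sum>k\<in>{0, n}. matrix_pow K k y y * 1 ^ k) \<le> green K y 1"
    unfolding green_def by (rule sum_le_suminf) auto
  then have "1 + matrix_pow K n y y \<le> 1" using n G by simp
  then show False using n(2)
    by (cases "matrix_pow K n y y") (auto simp: top_unique ennreal_1[symmetric] ennreal_plus[symmetric] simp del: ennreal_1 ennreal_plus)
qed

theorem conv_parameter_first_return_gf:
  assumes irr: "irreducible_matrix K"
  shows "conv_parameter_at K x = Sup {ennreal u | u. 0 \<le> u \<and> first_return_gf K y (ennreal u) \<le> 1}"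
    and "R_recurrent_at K x \<longleftrightarrow> first_return_gf K y (conv_parameter_at K x) = 1"
proof -
  define R where "R = conv_parameter_at K x"
  have fin: "R < \<infinity>" unfolding R_def by (rule conv_parameter_finite[OF irr])
  have key: "green K x u < \<infinity> \<longleftrightarrow> first_return_gf K y u < 1" for u
    using green_finite_iff[OF irr] green_finite_iff_first_return_gf by metis
  have below: "first_return_gf K y u < 1" if "u < R" for u
    using green_finite_below that key unfolding R_def by metis
  have above: "1 < first_return_gf K y u" if "R < u" "u < \<infinity>" for u
  proof -
    \<comment> \<open>At \<open>u\<close> itself divergence of the Green function gives only \<open>F(u) \<ge> 1\<close>; strictness comes from
        scaling up from a smaller \<open>v\<close> that is still above \<open>R\<close>.\<close>
    obtain v where v: "R < v" "v < u" using dense[OF \<open>R < u\<close>] by blast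
    have ge: "1 \<le> first_return_gf K y v"
      using green_infinite_above[of K x v] v key[of v] unfolding R_def by (auto simp: not_less)
    obtain a b where ab: "v = ennreal a" "u = ennreal b" "0 < a" "a < b"
    proof -
      have "0 < v" using v(1) by (rule le_less_trans[OF zero_le])
      with v(2) \<open>u < \<infinity>\<close> show ?thesis
        by (cases v; cases u) (auto simp: ennreal_less_iff intro: that)
    qed
    have "1 < ennreal (b / a)"
      using ab by (simp add: ennreal_1[symmetric] ennreal_less_iff del: ennreal_1)
    also have "ennreal (b / a) \<le> ennreal (b / a) * first_return_gf K y v"
      using mult_left_mono[OF ge, of "ennreal (b / a)"] by simp
    also have "\<dots> \<le> first_return_gf K y (ennreal (b / a) * v)"
      using ab by (intro first_return_gf_scale) (simp add: ennreal_1[symmetric] del: ennreal_1)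
    also have "ennreal (b / a) * v = u"
      using ab by (simp add: ennreal_mult[symmetric])
    finally show ?thesis .
  qed
  show "conv_parameter_at K x = Sup {ennreal u | u. 0 \<le> u \<and> first_return_gf K y (ennreal u) \<le> 1}"
    (is "_ = Sup ?U") unfolding R_def[symmetric]
  proof (rule antisym)
    show "Sup ?U \<le> R"
      using above by (intro Sup_least) (force simp: not_less[symmetric])
    show "R \<le> Sup ?U"
    proof (rule dense_le)
      fix v assume v: "v < R"
      then have "v \<in> ?U"
        using below[OF v] fin by (cases v) auto
      then show "v \<le> Sup ?U" by (rule Sup_upper)
    qed
  qed
  have "first_return_gf K y R \<le> 1"
    by (rule first_return_gf_left_limit_le[OF fin]) (simp add: below less_imp_le)
  moreover have "R_recurrent_at K x \<longleftrightarrow> \<not> green K x R < \<infinity>"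
    by (simp add: R_recurrent_at_def green_def R_def less_top[symmetric])
  ultimately show "R_recurrent_at K x \<longleftrightarrow> first_return_gf K y (conv_parameter_at K x) = 1"
    unfolding key R_def[symmetric] by auto
qed

section \<open>Feynman-Kac transforms\<close>

lemma markovian_part_pos_iff:
  "0 < markovian_part J \<gamma> x y \<longleftrightarrow> 0 < marginal_kernel J x y"
  unfolding markovian_part_def marginal_kernel_def nn_integral_count_space_pos_iff
  by (simp add: feynman_kac_def zero_less_mult_iff)

lemma irreducible_markovian_part:
  assumes "irreducible_matrix (marginal_kernel J)"
  shows "irreducible_matrix (markovian_part J \<gamma>)"
  using assms matrix_pow_pos_cong[of "markovian_part J \<gamma>" "marginal_kernel J", OF markovian_part_pos_iff]
  unfolding irreducible_matrix_def by simp

theorem lemma1: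
  fixes J :: "int \<times> 's::countable \<Rightarrow> (int \<times> 's) pmf"
    and \<gamma> :: real and x y :: 's
  assumes "markov_additive J"
    and "irreducible_matrix (marginal_kernel J)"
    and "\<And>a b. markovian_part J \<gamma> a b < \<infinity>"
  shows "conv_parameter_at (markovian_part J \<gamma>) x
           = Sup {ennreal u | u. 0 \<le> u \<and> Psi J y \<gamma> (ennreal u) \<le> 1}
         \<and> (R_recurrent_at (markovian_part J \<gamma>) x
           \<longleftrightarrow> Psi J y \<gamma> (conv_parameter_at (markovian_part J \<gamma>) x) = 1)"
  unfolding Psi_def
  using conv_parameter_first_return_gf[OF irreducible_markovian_part[OF assms(2)]] by blast

end
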